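(* Let $\mathsf{R}'_{\mathrm{BK}}$ be the single-conclusion Hilbert-style system described below and $\vdash_{\mathrm{BK}}$ be Bochvar-Kleene logic. Then $\vdash_{\mathsf{R}'_{\mathrm{BK}}} \;=\; \vdash_{\mathrm{BK}}$.
   Context: $L$ is the set of formulas built from a countably infinite set of propositional variables using binary $\land,\lor$ and unary $\neg$. Let $\mathbf{A}$ be the algebra on $\{f,u,t\}$ in which each connective, on arguments all in $\{f,t\}$, returns the classical Boolean value ($f$ false, $t$ true), and returns $u$ whenever some argument is $u$. Valuations are homomorphisms into $\mathbf A$. $\Gamma\vdash_{\mathrm{BK}}\varphi$ iff there is no valuation $v$ with $v[\Gamma]\subseteq\{t\}$ and $v(\varphi)\ne t$. A Set-Fmla Hilbert system is given by rule schemas $\gamma_1,\dots,\gamma_m/\varphi$ whose instances are all their substitution instances; $\Gamma\vdash_{\mathsf R}\varphi$ iff there is a finite sequence ending in $\varphi$ each member of which is in $\Gamma$ or the conclusion of a rule instance whose premises occur earlier. For a rule $\gamma_1,\dots,\gamma_m/\varphi$ and a variable $s$ not occurring in it, its $\lor$-lifted version is $s\lor\gamma_1,\dots,s\lor\gamma_m/s\lor\varphi$. $\mathsf{R}'_{\mathrm{BK}}$ has the following rule schemas ($p,q,r$ distinct variables): (1$\star$) $p,\neg p/q$; (2) $p/\neg\neg p$; (3) $\neg\neg p/p$; (4) $p,q/p\land q$; (5) $\neg p,\neg q/\neg(p\land q)$; (6) $\neg p,q/\neg(p\land q)$; (7) $p,\neg q/\neg(p\land q)$; (8$\star$) $\neg(p\land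 q)/\neg p\lor p$; (9$\star$) $\neg(p\land q)/\neg q\lor q$; (10) $p\land q/p$; (11) $p\land q/q$; (12) $\neg p,\neg q/\neg(p\lor q)$; (13) $\neg(p\lor q)/\neg p$; (14) $\neg(p\lor q)/\neg q$; (15$\star$) $p\lor q/p\lor\neg p$; (16$\star$) $p\lor q/q\lor\neg q$; (17) $\neg p,q/p\lor q$; (18) $p,\neg q/p\lor q$; (19) $p,q/p\lor q$; (20) $p\lor q,\neg p/q$; (21) $p\lor(q\lor r)/(p\lor q)\lor r$; (22) $p\lor p/p$; (23) $p\lor q/q\lor p$; (24) $p\lor q,r/\neg p\lor r$; together with the $\lor$-lifted versions of all of these rules except (1$\star$). *)

theory Defs
  imports Main
begin

section \<open>Formulas\<close>

datatype fm =
    Var nat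
  | Neg fm (\<open>\<^bold>\<not> _\<close> [90] 90)
  | Conj fm fm (infixr \<open>\<^bold>\<and>\<close> 80)
  | Disj fm fm (infixr \<open>\<^bold>\<or>\<close> 75)

primrec vars :: "fm \<Rightarrow> nat set" where
  "vars (Var x) = {x}"
| "vars (\<^bold>\<not> \<phi>) = vars \<phi>"
| "vars (\<phi> \<^bold>\<and> \<psi>) = vars \<phi> \<union> vars \<psi>"
| "vars (\<phi> \<^bold>\<or> \<psi>) = vars \<phi> \<union> vars \<psi>"

primrec subst :: "(nat \<Rightarrow> fm) \<Rightarrow> fm \<Rightarrow> fm" where
  "subst \<sigma> (Var x) = \<sigma> x"
| "subst \<sigma> (\<^bold>\<not> \<phi>) = \<^bold>\<not> (subst \<sigma> \<phi>)"
| "subst \<sigma> (\<phi> \<^bold>\<and> \<psi>) = subst \<sigma> \<phi> \<^bold>\<and> subst \<sigma> \<psi>"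
| "subst \<sigma> (\<phi> \<^bold>\<or> \<psi>) = subst \<sigma> \<phi> \<^bold>\<or> subst \<sigma> \<psi>"


section \<open>Bochvar-Kleene logic\<close>

datatype tv = F | U | T

fun neg_A :: "tv \<Rightarrow> tv" where
  "neg_A F = T"
| "neg_A U = U"
| "neg_A T = F"

fun conj_A :: "tv \<Rightarrow> tv \<Rightarrow> tv" where
  "conj_A U _ = U"
| "conj_A _ U = U"
| "conj_A F F = F"
| "conj_A F T = F"
| "conj_A T F = F"
| "conj_A T T = T"

fun disj_A :: "tv \<Rightarrow> tv \<Rightarrow> tv" where
  "disj_A U _ = U"
| "disj_A _ U = U"
| "disj_A F F = F"
| "disj_A F T = T"
| "disj_A T F = T"
| "disj_A T T = T"

definition valuation :: "(fm \<Rightarrow> tv) \<Rightarrow> bool" where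
  "valuation v \<longleftrightarrow>
     (\<forall>\<phi>. v (\<^bold>\<not> \<phi>) = neg_A (v \<phi>)) \<and>
     (\<forall>\<phi> \<psi>. v (\<phi> \<^bold>\<and> \<psi>) = conj_A (v \<phi>) (v \<psi>)) \<and>
     (\<forall>\<phi> \<psi>. v (\<phi> \<^bold>\<or> \<psi>) = disj_A (v \<phi>) (v \<psi>))"

definition BK_consequence :: "fm set \<Rightarrow> fm \<Rightarrow> bool" (infix \<open>\<turnstile>\<^sub>B\<^sub>K\<close> 50) where
  "\<Gamma> \<turnstile>\<^sub>B\<^sub>K \<phi> \<longleftrightarrow> \<not> (\<exists>v. valuation v \<and> v ` \<Gamma> \<subseteq> {T} \<and> v \<phi> \<noteq> T)"


section \<open>Set-Fmla Hilbert systems\<close>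

datatype rule = Rule (prems: "fm list") (concl: fm)

definition rule_vars :: "rule \<Rightarrow> nat set" where
  "rule_vars \<rho> = vars (concl \<rho>) \<union> (\<Union>\<gamma> \<in> set (prems \<rho>). vars \<gamma>)"

fun rule_instance :: "(nat \<Rightarrow> fm) \<Rightarrow> rule \<Rightarrow> rule" where
  "rule_instance \<sigma> (Rule \<gamma>s \<phi>) = Rule (map (subst \<sigma>) \<gamma>s) (subst \<sigma> \<phi>)"

definition is_derivation :: "rule set \<Rightarrow> fm set \<Rightarrow> fm list \<Rightarrow> bool" where
  "is_derivation R \<Gamma> \<phi>s \<longleftrightarrow>
     (\<forall>i < length \<phi>s. \<phi>s ! i \<in> \<Gamma> \<or>
        (\<exists>\<rho> \<in> R. \<exists>\<sigma>. concl (rule_instance \<sigma> \<rho>) = \<phi>s ! i \<and>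
           set (prems (rule_instance \<sigma> \<rho>)) \<subseteq> set (take i \<phi>s)))"

definition hilbert_consequence :: "rule set \<Rightarrow> fm set \<Rightarrow> fm \<Rightarrow> bool" where
  "hilbert_consequence R \<Gamma> \<phi> \<longleftrightarrow>
     (\<exists>\<phi>s. \<phi>s \<noteq> [] \<and> last \<phi>s = \<phi> \<and> is_derivation R \<Gamma> \<phi>s)"

fun disj_lift :: "nat \<Rightarrow> rule \<Rightarrow> rule" where
  "disj_lift s (Rule \<gamma>s \<phi>) = Rule (map (\<lambda>\<gamma>. Var s \<^bold>\<or> \<gamma>) \<gamma>s) (Var s \<^bold>\<or> \<phi>)"


section \<open>The Hilbert system for Bochvar-Kleene logic\<close>

definition explosion :: rule where
  "explosion = (let p = Var 0; q = Var 1 in Rule [p, \<^bold>\<not> p] q)"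

definition liftable_rules :: "rule set" where
  "liftable_rules = (let p = Var 0; q = Var 1; r = Var 2 in {
     Rule [p] (\<^bold>\<not> (\<^bold>\<not> p)),
     Rule [\<^bold>\<not> (\<^bold>\<not> p)] p,
     Rule [p, q] (p \<^bold>\<and> q),
     Rule [\<^bold>\<not> p, \<^bold>\<not> q] (\<^bold>\<not> (p \<^bold>\<and> q)),
     Rule [\<^bold>\<not> p, q] (\<^bold>\<not> (p \<^bold>\<and> q)),
     Rule [p, \<^bold>\<not> q] (\<^bold>\<not> (p \<^bold>\<and> q)),
     Rule [\<^bold>\<not> (p \<^bold>\<and> q)] (\<^bold>\<not> p \<^bold>\<or> p),
     Rule [\<^bold>\<not> (p \<^bold>\<and> q)] (\<^bold>\<not> q \<^bold>\<or> q),
     Rule [p \<^bold>\<and> q] p,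
     Rule [p \<^bold>\<and> q] q,
     Rule [\<^bold>\<not> p, \<^bold>\<not> q] (\<^bold>\<not> (p \<^bold>\<or> q)),
     Rule [\<^bold>\<not> (p \<^bold>\<or> q)] (\<^bold>\<not> p),
     Rule [\<^bold>\<not> (p \<^bold>\<or> q)] (\<^bold>\<not> q),
     Rule [p \<^bold>\<or> q] (p \<^bold>\<or> \<^bold>\<not> p),
     Rule [p \<^bold>\<or> q] (q \<^bold>\<or> \<^bold>\<not> q),
     Rule [\<^bold>\<not> p, q] (p \<^bold>\<or> q),
     Rule [p, \<^bold>\<not> q] (p \<^bold>\<or> q),
     Rule [p, q] (p \<^bold>\<or> q),
     Rule [p \<^bold>\<or> q, \<^bold>\<not> p] q,
     Rule [p \<^bold>\<or> (q \<^bold>\<or> r)] ((p \<^bold>\<or> q) \<^bold>\<or> r),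
     Rule [p \<^bold>\<or> p] p,
     Rule [p \<^bold>\<or> q] (q \<^bold>\<or> p),
     Rule [p \<^bold>\<or> q, r] (\<^bold>\<not> p \<^bold>\<or> r)})"

text \<open>The choice of the variable \<open>Var 3\<close> for lifting is immaterial: it occurs in none of the
  rules, and rules are applied up to substitution.\<close>

lemma lift_var_fresh: "\<rho> \<in> liftable_rules \<Longrightarrow> 3 \<notin> rule_vars \<rho>"
  by (auto simp: liftable_rules_def Let_def rule_vars_def)

definition R_BK' :: "rule set" where
  "R_BK' = insert explosion liftable_rules \<union> disj_lift 3 ` liftable_rules"

end

theory Submission
  imports Defs
begin

text \<open>Completeness: extend \<open>\<Gamma>\<close> to a set \<open>\<Delta>\<close> maximal among those not deriving \<open>\<phi>\<close>, and let a formula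
  be true if it is in \<open>\<Delta>\<close>, false if its negation is in \<open>\<Delta>\<close>, and undefined otherwise. This is a
  valuation provided that \<open>\<Delta>\<close> is prime, which follows from reasoning by cases: if \<open>\<phi>\<close> is derivable
  from \<open>\<alpha>\<close> and from \<open>\<beta>\<close>, then it is derivable from \<open>\<alpha> \<^bold>\<or> \<beta>\<close>. The lifted rules let us prefix a whole
  derivation with \<open>\<chi> \<^bold>\<or> _\<close>. Explosion has no sound lifted version, since its conclusion may be
  undefined while \<open>\<chi>\<close> is true, but \<open>\<chi> \<^bold>\<or> \<psi>\<close> and \<open>\<chi> \<^bold>\<or> \<^bold>\<not> \<psi>\<close> yield \<open>\<chi>\<close> itself, which is enough.\<close>

section \<open>Hilbert systems\<close>

lemma is_derivation_append:
  assumes "is_derivation R \<Gamma> xs" and "is_derivation R \<Gamma> ys"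
  shows "is_derivation R \<Gamma> (xs @ ys)"
  unfolding is_derivation_def
proof (intro allI impI)
  fix i assume i: "i < length (xs @ ys)"
  show "(xs @ ys) ! i \<in> \<Gamma> \<or> (\<exists>\<rho>\<in>R. \<exists>\<sigma>. concl (rule_instance \<sigma> \<rho>) = (xs @ ys) ! i \<and>
          set (prems (rule_instance \<sigma> \<rho>)) \<subseteq> set (take i (xs @ ys)))"
  proof (cases "i < length xs")
    case True
    then show ?thesis
      using assms(1) by (auto simp: is_derivation_def nth_append)
  next
    case False
    define j where "j = i - length xs"
    have j: "j < length ys" "i = length xs + j"
      using False i by (auto simp: j_def)
    have "ys ! j \<in> \<Gamma> \<or> (\<exists>\<rho>\<in>R. \<exists>\<sigma>. concl (rule_instance \<sigma> \<rho>) = ys ! j \<and>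
            set (prems (rule_instance \<sigma> \<rho>)) \<subseteq> set (take j ys))"
      using assms(2) j(1) by (simp add: is_derivation_def)
    then show ?thesis
      using j(2) by (simp add: nth_append) blast
  qed
qed

lemma hilbert_assumption:
  assumes "\<phi> \<in> \<Gamma>"
  shows "hilbert_consequence R \<Gamma> \<phi>"
  unfolding hilbert_consequence_def
  by (rule exI[of _ "[\<phi>]"]) (use assms in \<open>simp add: is_derivation_def\<close>)

text \<open>All premises of a rule application must occur in one sequence, so separate derivations
  are concatenated. Containment is enough, as premises may sit at any earlier positions in any
  order.\<close>

lemma hilbert_derivation_of_list:
  assumes "\<forall>\<gamma>\<in>set \<gamma>s. hilbert_consequence R \<Gamma> \<gamma>"
  shows "\<exists>\<phi>s. is_derivation R \<Gamma> \<phi>s \<and> set \<gamma>s \<subseteq> set \<phi>s"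
  using assms
proof (induction \<gamma>s)
  case Nil
  then show ?case by (auto simp: is_derivation_def intro: exI[of _ "[]"])
next
  case (Cons \<gamma> \<gamma>s)
  obtain xs where xs: "is_derivation R \<Gamma> xs" "set \<gamma>s \<subseteq> set xs"
    using Cons by auto
  obtain ys where ys: "ys \<noteq> []" "last ys = \<gamma>" "is_derivation R \<Gamma> ys"
    using Cons.prems by (auto simp: hilbert_consequence_def)
  have "set (\<gamma> # \<gamma>s) \<subseteq> set (xs @ ys)"
    using xs(2) ys(1,2) last_in_set[of ys] by auto
  then show ?case
    using is_derivation_append[OF xs(1) ys(3)] by blast
qed

lemma hilbert_rule:
  assumes "\<rho> \<in> R"
    and "\<forall>\<gamma>\<in>set (prems (rule_instance \<sigma> \<rho>)). hilbert_consequence R \<Gamma> \<gamma>"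
  shows "hilbert_consequence R \<Gamma> (concl (rule_instance \<sigma> \<rho>))"
proof -
  obtain xs where xs: "is_derivation R \<Gamma> xs" "set (prems (rule_instance \<sigma> \<rho>)) \<subseteq> set xs"
    using hilbert_derivation_of_list[OF assms(2)] by blast
  \<comment> \<open>The merged derivation of the premises is prolonged by one entry, which has all
    its premises before it.\<close>
  have "is_derivation R \<Gamma> (xs @ [concl (rule_instance \<sigma> \<rho>)])"
    unfolding is_derivation_def
  proof (intro allI impI)
    fix i assume i: "i < length (xs @ [concl (rule_instance \<sigma> \<rho>)])"
    show "(xs @ [concl (rule_instance \<sigma> \<rho>)]) ! i \<in> \<Gamma> \<or>
      (\<exists>\<rho>'\<in>R. \<exists>\<sigma>'. concl (rule_instance \<sigma>' \<rho>') = (xs @ [concl (rule_instance \<sigma> \<rho>)]) ! i \<and>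
        set (prems (rule_instance \<sigma>' \<rho>')) \<subseteq> set (take i (xs @ [concl (rule_instance \<sigma> \<rho>)])))"
    proof (cases "i < length xs")
      case True
      then show ?thesis
        using xs(1) by (auto simp: is_derivation_def nth_append)
    next
      case False
      then have "i = length xs" using i by simp
      then show ?thesis using assms(1) xs(2) by auto
    qed
  qed
  then show ?thesis
    unfolding hilbert_consequence_def by (metis last_snoc snoc_eq_iff_butlast)
qed

text \<open>Premises sit at smaller positions, so strong induction on the position applies. With
  \<open>hilbert_assumption\<close> and \<open>hilbert_rule\<close> this makes the derivable
  formulas the least set containing \<Gamma> and closed under rule instances.\<close>

lemma hilbert_induct [consumes 1, case_names assumption rule]:
  assumes "hilbert_consequence R \<Gamma> \<phi>"
    and ass: "\<And>\<psi>. \<psi> \<in> \<Gamma> \<Longrightarrow> P \<psi>"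
    and rule: "\<And>\<rho> \<sigma>. \<rho> \<in> R \<Longrightarrow> \<forall>\<gamma>\<in>set (prems (rule_instance \<sigma> \<rho>)). P \<gamma> \<Longrightarrow>
                 P (concl (rule_instance \<sigma> \<rho>))"
  shows "P \<phi>"
proof -
  obtain xs where xs: "xs \<noteq> []" "last xs = \<phi>" "is_derivation R \<Gamma> xs"
    using assms(1) by (auto simp: hilbert_consequence_def)
  have "P (xs ! i)" if "i < length xs" for i
    using that
  proof (induction i rule: less_induct)
    case (less i)
    from less.prems xs(3) consider "xs ! i \<in> \<Gamma>"
      | \<rho> \<sigma> where "\<rho> \<in> R" "concl (rule_instance \<sigma> \<rho>) = xs ! i"
          "set (prems (rule_instance \<sigma> \<rho>)) \<subseteq> set (take i xs)"
      unfolding is_derivation_def by blast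
    then show ?case
    proof cases
      case 1
      then show ?thesis by (rule ass)
    next
      case 2
      have "P \<gamma>" if \<gamma>: "\<gamma> \<in> set (prems (rule_instance \<sigma> \<rho>))" for \<gamma>
      proof -
        obtain j where "j < i" "j < length xs" "\<gamma> = xs ! j"
          using \<gamma> 2(3) by (fastforce simp: in_set_conv_nth)
        then show ?thesis using less.IH by simp
      qed
      then show ?thesis using rule[OF 2(1), of \<sigma>] 2(2) by simp
    qed
  qed
  from this[of "length xs - 1"] show ?thesis using xs(1,2) by (simp add: last_conv_nth)
qed

text \<open>The formulas derivable from \<Gamma> include \<Delta> and are closed under the rules.
  Monotonicity is the case where each member of \<Delta> is itself an assumption in
  \<Gamma>.\<close>

lemma hilbert_cut:
  assumes "hilbert_consequence R \<Delta> \<phi>" and "\<forall>\<delta>\<in>\<Delta>. hilbert_consequence R \<Gamma> \<delta>"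
  shows "hilbert_consequence R \<Gamma> \<phi>"
  using assms(1)
proof (induction rule: hilbert_induct)
  case (assumption \<psi>)
  then show ?case using assms(2) by blast
next
  case (rule \<rho> \<sigma>)
  then show ?case by (rule hilbert_rule)
qed

lemma hilbert_finite:
  assumes "hilbert_consequence R \<Gamma> \<phi>"
  obtains \<Gamma>\<^sub>0 where "finite \<Gamma>\<^sub>0" "\<Gamma>\<^sub>0 \<subseteq> \<Gamma>" "hilbert_consequence R \<Gamma>\<^sub>0 \<phi>"
proof -
  obtain xs where xs: "xs \<noteq> []" "last xs = \<phi>" "is_derivation R \<Gamma> xs"
    using assms by (auto simp: hilbert_consequence_def)
  \<comment> \<open>A sequence uses only assumptions that occur in it, and a list has finitely many
    entries.\<close>
  then have "is_derivation R (\<Gamma> \<inter> set xs) xs"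
    unfolding is_derivation_def by auto
  then have "hilbert_consequence R (\<Gamma> \<inter> set xs) \<phi>"
    using xs(1,2) unfolding hilbert_consequence_def by blast
  then show ?thesis using that[of "\<Gamma> \<inter> set xs"] by simp
qed

text \<open>Zorn's lemma on the supersets of \<Gamma> that do not derive \<phi>. No connective is
  involved, so \<open>R\<close> is arbitrary.\<close>

lemma hilbert_Lindenbaum:
  assumes "\<not> hilbert_consequence R \<Gamma> \<phi>"
  obtains \<Delta> where "\<Gamma> \<subseteq> \<Delta>" "\<And>\<psi>. hilbert_consequence R \<Delta> \<psi> \<longleftrightarrow> \<psi> \<in> \<Delta>" "\<phi> \<notin> \<Delta>"
    "\<And>\<psi>. \<psi> \<notin> \<Delta> \<Longrightarrow> hilbert_consequence R (insert \<psi> \<Delta>) \<phi>"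
proof -
  define \<A> where "\<A> = {\<Delta>. \<Gamma> \<subseteq> \<Delta> \<and> \<not> hilbert_consequence R \<Delta> \<phi>}"
  have "\<exists>M\<in>\<A>. \<forall>X\<in>\<A>. M \<subseteq> X \<longrightarrow> X = M"
  proof (rule subset_Zorn_nonempty)
    show "\<A> \<noteq> {}" using assms by (auto simp: \<A>_def)
  next
    fix \<C> assume ne: "\<C> \<noteq> {}" and chain: "subset.chain \<A> \<C>"
    have "\<C> \<subseteq> \<A>" using chain by (simp add: subset.chain_def)
    have "\<not> hilbert_consequence R (\<Union>\<C>) \<phi>"
    proof
      assume "hilbert_consequence R (\<Union>\<C>) \<phi>"
      then obtain \<Gamma>\<^sub>0 where \<Gamma>\<^sub>0: "finite \<Gamma>\<^sub>0" "\<Gamma>\<^sub>0 \<subseteq> \<Union>\<C>" "hilbert_consequence R \<Gamma>\<^sub>0 \<phi>"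
        by (rule hilbert_finite)
      \<comment> \<open>Finitely many formulas from the union of a nonempty chain already lie in a
        single member.\<close>
      obtain X where "X \<in> \<C>" "\<Gamma>\<^sub>0 \<subseteq> X"
        using finite_subset_Union_chain[OF \<Gamma>\<^sub>0(1,2) ne chain] by blast
      then have "hilbert_consequence R X \<phi>"
        using hilbert_cut[OF \<Gamma>\<^sub>0(3)] hilbert_assumption by blast
      then show False using \<open>X \<in> \<C>\<close> \<open>\<C> \<subseteq> \<A>\<close> by (auto simp: \<A>_def)
    qed
    then show "\<Union>\<C> \<in> \<A>" using ne \<open>\<C> \<subseteq> \<A>\<close> by (auto simp: \<A>_def)
  qed
  then obtain \<Delta> where "\<Delta> \<in> \<A>" and max: "\<And>X. X \<in> \<A> \<Longrightarrow> \<Delta> \<subseteq> X \<Longrightarrow> X = \<Delta>"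
    by blast
  then have \<Delta>: "\<Gamma> \<subseteq> \<Delta>" "\<not> hilbert_consequence R \<Delta> \<phi>"
    by (simp_all add: \<A>_def)
  have ext: "hilbert_consequence R (insert \<psi> \<Delta>) \<phi>" if "\<psi> \<notin> \<Delta>" for \<psi>
    using max[of "insert \<psi> \<Delta>"] that \<Delta>(1) by (auto simp: \<A>_def)
  \<comment> \<open>If \<psi> were derivable but missing, \<open>ext\<close> would derive \<phi>
    with the help of \<psi>, and cutting \<psi> would derive \<phi> from \<Delta>.\<close>
  have "\<psi> \<in> \<Delta>" if "hilbert_consequence R \<Delta> \<psi>" for \<psi>
    using hilbert_cut[OF ext, of \<psi> \<Delta>] that \<Delta>(2) hilbert_assumption by blast
  then have "hilbert_consequence R \<Delta> \<psi> \<longleftrightarrow> \<psi> \<in> \<Delta>" for \<psi>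
    using hilbert_assumption by blast
  then show ?thesis using that[of \<Delta>] \<Delta> ext by simp
qed

section \<open>Derived rules\<close>

abbreviation BK_derives :: "fm set \<Rightarrow> fm \<Rightarrow> bool" (infix \<open>\<turnstile>\<close> 50) where
  "\<Gamma> \<turnstile> \<phi> \<equiv> hilbert_consequence R_BK' \<Gamma> \<phi>"

section \<open>Rule schemas as inference rules on derivability, plain and behind a side
  formula\<close>

lemma subst_cong: "(\<And>x. x \<in> vars \<phi> \<Longrightarrow> \<sigma> x = \<tau> x) \<Longrightarrow> subst \<sigma> \<phi> = subst \<tau> \<phi>"
  by (induction \<phi>) auto

lemma liftable_rule:
  assumes "\<rho> \<in> liftable_rules" and "\<forall>\<gamma>\<in>set (prems \<rho>). \<Gamma> \<turnstile> subst \<sigma> \<gamma>"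
  shows "\<Gamma> \<turnstile> subst \<sigma> (concl \<rho>)"
  using hilbert_rule[of \<rho> R_BK' \<sigma> \<Gamma>] assms by (cases \<rho>) (auto simp: R_BK'_def)

text \<open>The lifting variable is a placeholder: substituting \<chi> for it gives an arbitrary
  side formula, and its freshness leaves the rest as instantiated by \<sigma>.\<close>

lemma lifted_rule:
  assumes "\<rho> \<in> liftable_rules" and "\<forall>\<gamma>\<in>set (prems \<rho>). \<Gamma> \<turnstile> \<chi> \<^bold>\<or> subst \<sigma> \<gamma>"
  shows "\<Gamma> \<turnstile> \<chi> \<^bold>\<or> subst \<sigma> (concl \<rho>)"
proof (cases \<rho>)
  case (Rule \<gamma>s \<phi>)
  define \<tau> where "\<tau> = \<sigma>(3 := \<chi>)"
  have eq: "subst \<tau> \<psi> = subst \<sigma> \<psi>" if "\<psi> \<in> insert \<phi> (set \<gamma>s)" for \<psi>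
    using lift_var_fresh[OF assms(1)] that Rule
    by (intro subst_cong) (auto simp: \<tau>_def rule_vars_def)
  have "\<Gamma> \<turnstile> concl (rule_instance \<tau> (disj_lift 3 \<rho>))"
  proof (rule hilbert_rule)
    show "disj_lift 3 \<rho> \<in> R_BK'" using assms(1) by (simp add: R_BK'_def)
    show "\<forall>\<gamma>\<in>set (prems (rule_instance \<tau> (disj_lift 3 \<rho>))). \<Gamma> \<turnstile> \<gamma>"
      using assms(2) eq by (auto simp: Rule \<tau>_def)
  qed
  then show ?thesis using eq[of \<phi>] by (simp add: Rule \<tau>_def)
qed

lemma BK_explosion: "\<Gamma> \<turnstile> p \<Longrightarrow> \<Gamma> \<turnstile> \<^bold>\<not> p \<Longrightarrow> \<Gamma> \<turnstile> q"
  using hilbert_rule[of explosion R_BK' "\<lambda>n. if n = 0 then p else q" \<Gamma>]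
  by (simp add: R_BK'_def explosion_def Let_def)

lemma
  shows negneg_I: "\<Gamma> \<turnstile> p \<Longrightarrow> \<Gamma> \<turnstile> \<^bold>\<not> (\<^bold>\<not> p)"
    and negneg_D: "\<Gamma> \<turnstile> \<^bold>\<not> (\<^bold>\<not> p) \<Longrightarrow> \<Gamma> \<turnstile> p"
    and conj_I: "\<Gamma> \<turnstile> p \<Longrightarrow> \<Gamma> \<turnstile> q \<Longrightarrow> \<Gamma> \<turnstile> p \<^bold>\<and> q"
    and neg_conj_FF: "\<Gamma> \<turnstile> \<^bold>\<not> p \<Longrightarrow> \<Gamma> \<turnstile> \<^bold>\<not> q \<Longrightarrow> \<Gamma> \<turnstile> \<^bold>\<not> (p \<^bold>\<and> q)"
    and neg_conj_FT: "\<Gamma> \<turnstile> \<^bold>\<not> p \<Longrightarrow> \<Gamma> \<turnstile> q \<Longrightarrow> \<Gamma> \<turnstile> \<^bold>\<not> (p \<^bold>\<and> q)"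
    and neg_conj_TF: "\<Gamma> \<turnstile> p \<Longrightarrow> \<Gamma> \<turnstile> \<^bold>\<not> q \<Longrightarrow> \<Gamma> \<turnstile> \<^bold>\<not> (p \<^bold>\<and> q)"
    and neg_conj_defined1: "\<Gamma> \<turnstile> \<^bold>\<not> (p \<^bold>\<and> q) \<Longrightarrow> \<Gamma> \<turnstile> \<^bold>\<not> p \<^bold>\<or> p"
    and neg_conj_defined2: "\<Gamma> \<turnstile> \<^bold>\<not> (p \<^bold>\<and> q) \<Longrightarrow> \<Gamma> \<turnstile> \<^bold>\<not> q \<^bold>\<or> q"
    and conj_D1: "\<Gamma> \<turnstile> p \<^bold>\<and> q \<Longrightarrow> \<Gamma> \<turnstile> p"
    and conj_D2: "\<Gamma> \<turnstile> p \<^bold>\<and> q \<Longrightarrow> \<Gamma> \<turnstile> q"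
    and neg_disj_I: "\<Gamma> \<turnstile> \<^bold>\<not> p \<Longrightarrow> \<Gamma> \<turnstile> \<^bold>\<not> q \<Longrightarrow> \<Gamma> \<turnstile> \<^bold>\<not> (p \<^bold>\<or> q)"
    and neg_disj_D1: "\<Gamma> \<turnstile> \<^bold>\<not> (p \<^bold>\<or> q) \<Longrightarrow> \<Gamma> \<turnstile> \<^bold>\<not> p"
    and neg_disj_D2: "\<Gamma> \<turnstile> \<^bold>\<not> (p \<^bold>\<or> q) \<Longrightarrow> \<Gamma> \<turnstile> \<^bold>\<not> q"
    and disj_defined1: "\<Gamma> \<turnstile> p \<^bold>\<or> q \<Longrightarrow> \<Gamma> \<turnstile> p \<^bold>\<or> \<^bold>\<not> p"
    and disj_defined2: "\<Gamma> \<turnstile> p \<^bold>\<or> q \<Longrightarrow> \<Gamma> \<turnstile> q \<^bold>\<or> \<^bold>\<not> q"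
    and disj_FT: "\<Gamma> \<turnstile> \<^bold>\<not> p \<Longrightarrow> \<Gamma> \<turnstile> q \<Longrightarrow> \<Gamma> \<turnstile> p \<^bold>\<or> q"
    and disj_TF: "\<Gamma> \<turnstile> p \<Longrightarrow> \<Gamma> \<turnstile> \<^bold>\<not> q \<Longrightarrow> \<Gamma> \<turnstile> p \<^bold>\<or> q"
    and disj_TT: "\<Gamma> \<turnstile> p \<Longrightarrow> \<Gamma> \<turnstile> q \<Longrightarrow> \<Gamma> \<turnstile> p \<^bold>\<or> q"
    and disj_assoc: "\<Gamma> \<turnstile> p \<^bold>\<or> (q \<^bold>\<or> r) \<Longrightarrow> \<Gamma> \<turnstile> (p \<^bold>\<or> q) \<^bold>\<or> r"
    and disj_idem: "\<Gamma> \<turnstile> p \<^bold>\<or> p \<Longrightarrow> \<Gamma> \<turnstile> p"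
    and disj_commute: "\<Gamma> \<turnstile> p \<^bold>\<or> q \<Longrightarrow> \<Gamma> \<turnstile> q \<^bold>\<or> p"
    and disj_exchange: "\<Gamma> \<turnstile> p \<^bold>\<or> q \<Longrightarrow> \<Gamma> \<turnstile> r \<Longrightarrow> \<Gamma> \<turnstile> \<^bold>\<not> p \<^bold>\<or> r"
proof -
  have "\<forall>\<rho>\<in>liftable_rules. (\<forall>\<gamma>\<in>set (prems \<rho>). \<Gamma> \<turnstile> subst \<sigma> \<gamma>) \<longrightarrow> \<Gamma> \<turnstile> subst \<sigma> (concl \<rho>)" for \<sigma>
    using liftable_rule by blast
  \<comment> \<open>One substitution serves every schema, as only the variables 0, 1 and 2 occur.
    Simplification turns the quantifier over the rule set into a conjunction of
    implications.\<close>
  note rules = this[of "\<lambda>n. if n = 0 then p else if n = 1 then q else r",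
      unfolded liftable_rules_def Let_def, simplified]
  show "\<Gamma> \<turnstile> p \<Longrightarrow> \<Gamma> \<turnstile> \<^bold>\<not> (\<^bold>\<not> p)" "\<Gamma> \<turnstile> \<^bold>\<not> (\<^bold>\<not> p) \<Longrightarrow> \<Gamma> \<turnstile> p"
    "\<Gamma> \<turnstile> p \<Longrightarrow> \<Gamma> \<turnstile> q \<Longrightarrow> \<Gamma> \<turnstile> p \<^bold>\<and> q"
    "\<Gamma> \<turnstile> \<^bold>\<not> p \<Longrightarrow> \<Gamma> \<turnstile> \<^bold>\<not> q \<Longrightarrow> \<Gamma> \<turnstile> \<^bold>\<not> (p \<^bold>\<and> q)"
    "\<Gamma> \<turnstile> \<^bold>\<not> p \<Longrightarrow> \<Gamma> \<turnstile> q \<Longrightarrow> \<Gamma> \<turnstile> \<^bold>\<not> (p \<^bold>\<and> q)"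
    "\<Gamma> \<turnstile> p \<Longrightarrow> \<Gamma> \<turnstile> \<^bold>\<not> q \<Longrightarrow> \<Gamma> \<turnstile> \<^bold>\<not> (p \<^bold>\<and> q)"
    "\<Gamma> \<turnstile> \<^bold>\<not> (p \<^bold>\<and> q) \<Longrightarrow> \<Gamma> \<turnstile> \<^bold>\<not> p \<^bold>\<or> p" "\<Gamma> \<turnstile> \<^bold>\<not> (p \<^bold>\<and> q) \<Longrightarrow> \<Gamma> \<turnstile> \<^bold>\<not> q \<^bold>\<or> q"
    "\<Gamma> \<turnstile> p \<^bold>\<and> q \<Longrightarrow> \<Gamma> \<turnstile> p" "\<Gamma> \<turnstile> p \<^bold>\<and> q \<Longrightarrow> \<Gamma> \<turnstile> q"
    "\<Gamma> \<turnstile> \<^bold>\<not> p \<Longrightarrow> \<Gamma> \<turnstile> \<^bold>\<not> q \<Longrightarrow> \<Gamma> \<turnstile> \<^bold>\<not> (p \<^bold>\<or> q)"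
    "\<Gamma> \<turnstile> \<^bold>\<not> (p \<^bold>\<or> q) \<Longrightarrow> \<Gamma> \<turnstile> \<^bold>\<not> p" "\<Gamma> \<turnstile> \<^bold>\<not> (p \<^bold>\<or> q) \<Longrightarrow> \<Gamma> \<turnstile> \<^bold>\<not> q"
    "\<Gamma> \<turnstile> p \<^bold>\<or> q \<Longrightarrow> \<Gamma> \<turnstile> p \<^bold>\<or> \<^bold>\<not> p" "\<Gamma> \<turnstile> p \<^bold>\<or> q \<Longrightarrow> \<Gamma> \<turnstile> q \<^bold>\<or> \<^bold>\<not> q"
    "\<Gamma> \<turnstile> \<^bold>\<not> p \<Longrightarrow> \<Gamma> \<turnstile> q \<Longrightarrow> \<Gamma> \<turnstile> p \<^bold>\<or> q" "\<Gamma> \<turnstile> p \<Longrightarrow> \<Gamma> \<turnstile> \<^bold>\<not> q \<Longrightarrow> \<Gamma> \<turnstile> p \<^bold>\<or> q"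
    "\<Gamma> \<turnstile> p \<Longrightarrow> \<Gamma> \<turnstile> q \<Longrightarrow> \<Gamma> \<turnstile> p \<^bold>\<or> q"
    "\<Gamma> \<turnstile> p \<^bold>\<or> (q \<^bold>\<or> r) \<Longrightarrow> \<Gamma> \<turnstile> (p \<^bold>\<or> q) \<^bold>\<or> r" "\<Gamma> \<turnstile> p \<^bold>\<or> p \<Longrightarrow> \<Gamma> \<turnstile> p"
    "\<Gamma> \<turnstile> p \<^bold>\<or> q \<Longrightarrow> \<Gamma> \<turnstile> q \<^bold>\<or> p" "\<Gamma> \<turnstile> p \<^bold>\<or> q \<Longrightarrow> \<Gamma> \<turnstile> r \<Longrightarrow> \<Gamma> \<turnstile> \<^bold>\<not> p \<^bold>\<or> r"
    \<comment> \<open>Several rules share a conclusion; backtracking over \<open>erule mp\<close>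
      finds the one whose premises are at hand.\<close>
    using rules by - (elim conjE, erule mp, (intro conjI)?, assumption+)+
qed

text \<open>\<open>lifted_negneg_D\<close> serves \<open>disj_weaken\<close>; the other two serve
  \<open>lifted_contradiction\<close>.\<close>

lemma
  shows lifted_negneg_D: "\<Gamma> \<turnstile> \<chi> \<^bold>\<or> \<^bold>\<not> (\<^bold>\<not> p) \<Longrightarrow> \<Gamma> \<turnstile> \<chi> \<^bold>\<or> p"
    and lifted_disj_TF: "\<Gamma> \<turnstile> \<chi> \<^bold>\<or> p \<Longrightarrow> \<Gamma> \<turnstile> \<chi> \<^bold>\<or> \<^bold>\<not> q \<Longrightarrow> \<Gamma> \<turnstile> \<chi> \<^bold>\<or> (p \<^bold>\<or> q)"
    and lifted_disj_syllogism: "\<Gamma> \<turnstile> \<chi> \<^bold>\<or> (p \<^bold>\<or> q) \<Longrightarrow> \<Gamma> \<turnstile> \<chi> \<^bold>\<or> \<^bold>\<not> p \<Longrightarrow> \<Gamma> \<turnstile> \<chi> \<^bold>\<or> q"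
proof -
  have "\<forall>\<rho>\<in>liftable_rules. (\<forall>\<gamma>\<in>set (prems \<rho>). \<Gamma> \<turnstile> \<chi> \<^bold>\<or> subst \<sigma> \<gamma>) \<longrightarrow>
      \<Gamma> \<turnstile> \<chi> \<^bold>\<or> subst \<sigma> (concl \<rho>)" for \<sigma>
    using lifted_rule by blast
  note rules = this[of "\<lambda>n. if n = 0 then p else q",
      unfolded liftable_rules_def Let_def, simplified]
  show "\<Gamma> \<turnstile> \<chi> \<^bold>\<or> \<^bold>\<not> (\<^bold>\<not> p) \<Longrightarrow> \<Gamma> \<turnstile> \<chi> \<^bold>\<or> p"
    "\<Gamma> \<turnstile> \<chi> \<^bold>\<or> p \<Longrightarrow> \<Gamma> \<turnstile> \<chi> \<^bold>\<or> \<^bold>\<not> q \<Longrightarrow> \<Gamma> \<turnstile> \<chi> \<^bold>\<or> (p \<^bold>\<or> q)"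
    "\<Gamma> \<turnstile> \<chi> \<^bold>\<or> (p \<^bold>\<or> q) \<Longrightarrow> \<Gamma> \<turnstile> \<chi> \<^bold>\<or> \<^bold>\<not> p \<Longrightarrow> \<Gamma> \<turnstile> \<chi> \<^bold>\<or> q"
    using rules by - (elim conjE, erule mp, (intro conjI)?, assumption+)+
qed

text \<open>Alternating commutation with the given associativity rotates the three disjuncts
  cyclically until p stands in front.\<close>

lemma disj_assoc': "\<Gamma> \<turnstile> (p \<^bold>\<or> q) \<^bold>\<or> r \<Longrightarrow> \<Gamma> \<turnstile> p \<^bold>\<or> (q \<^bold>\<or> r)"
  by (rule disj_commute, rule disj_assoc, rule disj_commute, rule disj_assoc, rule disj_commute)

text \<open>From \<gamma> alone \<chi> \<or> \<gamma> does not follow, since \<chi> may be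
  undefined. The premise \<chi> \<or> \<alpha> certifies that \<chi> is defined.\<close>

lemma disj_weaken:
  assumes "\<Gamma> \<turnstile> \<chi> \<^bold>\<or> \<alpha>" and "\<Gamma> \<turnstile> \<gamma>"
  shows "\<Gamma> \<turnstile> \<chi> \<^bold>\<or> \<gamma>"
proof -
  \<comment> \<open>\<open>disj_exchange\<close> negates the left disjunct, so it is applied twice.
    The double negation is then removed behind the side formula \<gamma>.\<close>
  have "\<Gamma> \<turnstile> \<^bold>\<not> (\<^bold>\<not> \<chi>) \<^bold>\<or> \<gamma>"
    using assms by (blast intro: disj_exchange)
  then show ?thesis by (blast intro: disj_commute lifted_negneg_D)
qed

lemma lifted_contradiction:
  assumes "\<Gamma> \<turnstile> \<chi> \<^bold>\<or> p" and "\<Gamma> \<turnstile> \<chi> \<^bold>\<or> \<^bold>\<not> p"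
  shows "\<Gamma> \<turnstile> \<chi>"
proof -
  \<comment> \<open>\<open>disj_defined1\<close> supplies \<chi> \<or> \<not>\<chi>, so lifted
    introduction can add \<chi> as a second disjunct next to p. Resolving p away then leaves \<chi>
    \<or> \<chi>.\<close>
  have "\<Gamma> \<turnstile> \<chi> \<^bold>\<or> (p \<^bold>\<or> \<chi>)"
    using assms(1) disj_defined1[OF assms(1)] by (rule lifted_disj_TF)
  then show ?thesis
    using assms(2) by (rule disj_idem[OF lifted_disj_syllogism])
qed

text \<open>Induction along the derivation prefixes each entry with \<chi>. The alternative \<Gamma>
  \<turnstile> \<chi> is there for explosion, whose prefixed premises yield \<chi> but need not
  yield \<chi> \<or> \<phi> for an unrelated \<phi>.\<close>

lemma disj_lift_derivation:
  assumes "insert \<alpha> \<Gamma> \<turnstile> \<phi>" and \<chi>\<alpha>: "\<Gamma> \<turnstile> \<chi> \<^bold>\<or> \<alpha>"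
  shows "\<Gamma> \<turnstile> \<chi> \<or> \<Gamma> \<turnstile> \<chi> \<^bold>\<or> \<phi>"
proof (cases "\<Gamma> \<turnstile> \<chi>")
  case False
  from assms(1) have "\<Gamma> \<turnstile> \<chi> \<^bold>\<or> \<phi>"
  proof (induction rule: hilbert_induct)
    case (assumption \<psi>)
    then show ?case using \<chi>\<alpha> disj_weaken[OF \<chi>\<alpha>] hilbert_assumption by blast
  next
    case (rule \<rho> \<sigma>)
    from rule.hyps consider "\<rho> = explosion" | "\<rho> \<in> liftable_rules"
      | \<rho>' where "\<rho>' \<in> liftable_rules" "\<rho> = disj_lift 3 \<rho>'"
      by (auto simp: R_BK'_def)
    then show ?case
    proof cases
      case 1
      then have "\<Gamma> \<turnstile> \<chi> \<^bold>\<or> \<sigma> 0" "\<Gamma> \<turnstile> \<chi> \<^bold>\<or> \<^bold>\<not> (\<sigma> 0)"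
        using rule by (auto simp: explosion_def Let_def)
      then show ?thesis using lifted_contradiction False by blast
    next
      case 2
      then show ?thesis
        using rule lifted_rule[OF 2, of \<Gamma> \<chi> \<sigma>] by (cases \<rho>) auto
    next
      case 3
      \<comment> \<open>Reassociation merges \<chi> with the side formula \<open>\<sigma> 3\<close>
        of the lifted rule into one side formula, so a single level of lifting suffices.\<close>
      have "\<Gamma> \<turnstile> (\<chi> \<^bold>\<or> \<sigma> 3) \<^bold>\<or> subst \<sigma> (concl \<rho>')"
      proof (rule lifted_rule[OF 3(1)])
        show "\<forall>\<gamma>\<in>set (prems \<rho>'). \<Gamma> \<turnstile> (\<chi> \<^bold>\<or> \<sigma> 3) \<^bold>\<or> subst \<sigma> \<gamma>"
          using rule 3(2) by (cases \<rho>') (auto intro: disj_assoc)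
      qed
      then show ?thesis using 3(2) by (cases \<rho>') (auto intro: disj_assoc')
    qed
  qed
  then show ?thesis ..
qed simp

text \<open>The derivation from \<alpha> is lifted by \<beta>, turning \<beta> \<or> \<alpha> into
  \<beta> \<or> \<phi>. The derivation from \<beta> is then lifted by \<phi> itself, so both of its
  outcomes, \<phi> and \<phi> \<or> \<phi>, give \<phi>.\<close>

lemma disj_cases:
  assumes "\<Gamma> \<turnstile> \<alpha> \<^bold>\<or> \<beta>" and "insert \<alpha> \<Gamma> \<turnstile> \<phi>" and "insert \<beta> \<Gamma> \<turnstile> \<phi>"
  shows "\<Gamma> \<turnstile> \<phi>"
proof (cases "\<Gamma> \<turnstile> \<beta>")
  case True
  then show ?thesis
    using hilbert_cut[OF assms(3)] hilbert_assumption by blast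
next
  case False
  then have "\<Gamma> \<turnstile> \<beta> \<^bold>\<or> \<phi>"
    using disj_lift_derivation[OF assms(2) disj_commute[OF assms(1)]] by blast
  then show ?thesis
    using disj_lift_derivation[OF assms(3) disj_commute] disj_idem by blast
qed

section \<open>Soundness and completeness\<close>

lemma tv_disj_eq_T: "disj_A x y = T \<longleftrightarrow> x \<noteq> U \<and> y \<noteq> U \<and> (x = T \<or> y = T)"
  by (cases x; cases y) auto

lemma tv_disj_eq_F: "disj_A x y = F \<longleftrightarrow> x = F \<and> y = F"
  by (cases x; cases y) auto

lemma tv_conj_eq_T: "conj_A x y = T \<longleftrightarrow> x = T \<and> y = T"
  by (cases x; cases y) auto

lemma tv_conj_eq_F: "conj_A x y = F \<longleftrightarrow> x \<noteq> U \<and> y \<noteq> U \<and> (x = F \<or> y = F)"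
  by (cases x; cases y) auto

lemma tv_neg_eq: "neg_A x = T \<longleftrightarrow> x = F" "neg_A x = F \<longleftrightarrow> x = T"
  by (cases x; simp)+

text \<open>Reduces the homomorphism conditions of the canonical valuation to membership of a
  formula and of its negation in the maximal set.\<close>

lemma tv_eqI: "(x = T \<longleftrightarrow> y = T) \<Longrightarrow> (x = F \<longleftrightarrow> y = F) \<Longrightarrow> x = y"
  by (cases x; cases y) auto

text \<open>For soundness of a lifted rule: some premise must force the side formula to be
  defined.\<close>

lemma liftable_rule_prems_nonempty: "\<rho> \<in> liftable_rules \<Longrightarrow> prems \<rho> \<noteq> []"
  by (auto simp: liftable_rules_def Let_def)

text \<open>Preservation of definedness is what lifting requires: when the side formula is true,
  true lifted premises say of the original premises only that they are defined. Explosion lacks this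
  property.\<close>

lemma liftable_rule_sound:
  assumes v: "valuation v" and \<rho>: "\<rho> \<in> liftable_rules"
  shows liftable_rule_preserves_T:
      "\<forall>\<gamma>\<in>set (prems \<rho>). v (subst \<sigma> \<gamma>) = T \<Longrightarrow> v (subst \<sigma> (concl \<rho>)) = T"
    and liftable_rule_preserves_defined:
      "\<forall>\<gamma>\<in>set (prems \<rho>). v (subst \<sigma> \<gamma>) \<noteq> U \<Longrightarrow> v (subst \<sigma> (concl \<rho>)) \<noteq> U"
proof -
  have hom: "v (\<^bold>\<not> p) = neg_A (v p)" "v (p \<^bold>\<and> q) = conj_A (v p) (v q)"
    "v (p \<^bold>\<or> q) = disj_A (v p) (v q)" for p q
    using v by (auto simp: valuation_def)
  have "\<forall>\<rho>\<in>liftable_rules.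
      ((\<forall>\<gamma>\<in>set (prems \<rho>). v (subst \<sigma> \<gamma>) = T) \<longrightarrow> v (subst \<sigma> (concl \<rho>)) = T) \<and>
      ((\<forall>\<gamma>\<in>set (prems \<rho>). v (subst \<sigma> \<gamma>) \<noteq> U) \<longrightarrow> v (subst \<sigma> (concl \<rho>)) \<noteq> U)"
    unfolding liftable_rules_def Let_def
    \<comment> \<open>The rules contain three variables, so 27 assignments decide the claim.\<close>
    by (cases "v (\<sigma> 0)"; cases "v (\<sigma> (Suc 0))"; cases "v (\<sigma> 2)"; simp add: hom)
  from bspec[OF this \<rho>]
  show "\<forall>\<gamma>\<in>set (prems \<rho>). v (subst \<sigma> \<gamma>) = T \<Longrightarrow> v (subst \<sigma> (concl \<rho>)) = T"
    and "\<forall>\<gamma>\<in>set (prems \<rho>). v (subst \<sigma> \<gamma>) \<noteq> U \<Longrightarrow> v (subst \<sigma> (concl \<rho>)) \<noteq> U"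
    by simp_all
qed

lemma BK_sound:
  assumes "\<Gamma> \<turnstile> \<phi>"
  shows "\<Gamma> \<turnstile>\<^sub>B\<^sub>K \<phi>"
proof -
  have "v \<phi> = T" if v: "valuation v" and \<Gamma>: "v ` \<Gamma> \<subseteq> {T}" for v
    using assms
  proof (induction rule: hilbert_induct)
    case (assumption \<psi>)
    then show ?case using \<Gamma> by auto
  next
    case (rule \<rho> \<sigma>)
    from rule.hyps consider "\<rho> = explosion" | "\<rho> \<in> liftable_rules"
      | \<rho>' where "\<rho>' \<in> liftable_rules" "\<rho> = disj_lift 3 \<rho>'"
      by (auto simp: R_BK'_def)
    then show ?case
    proof cases
      case 1
      then show ?thesis
        using rule v by (auto simp: explosion_def Let_def valuation_def)
    next
      case 2
      then show ?thesis
        using rule liftable_rule_preserves_T[OF v 2, of \<sigma>] by (cases \<rho>) auto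
    next
      case 3
      have disj: "v (p \<^bold>\<or> q) = disj_A (v p) (v q)" for p q
        using v by (simp add: valuation_def)
      have *: "\<forall>\<gamma>\<in>set (prems \<rho>'). disj_A (v (\<sigma> 3)) (v (subst \<sigma> \<gamma>)) = T"
        using rule 3(2) by (cases \<rho>') (auto simp: disj)
      \<comment> \<open>The side formula is defined by way of some premise. If it is true,
        preservation of definedness applies; if false, every original premise is true and
        preservation of truth applies.\<close>
      have "disj_A (v (\<sigma> 3)) (v (subst \<sigma> (concl \<rho>'))) = T"
        using * liftable_rule_sound[OF v 3(1), of \<sigma>] liftable_rule_prems_nonempty[OF 3(1)]
        by (cases "prems \<rho>'") (auto simp: tv_disj_eq_T)
      then show ?thesis using 3(2) by (cases \<rho>') (simp add: disj)
    qed
  qed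
  then show ?thesis unfolding BK_consequence_def by blast
qed

lemma BK_complete:
  assumes "\<Gamma> \<turnstile>\<^sub>B\<^sub>K \<phi>"
  shows "\<Gamma> \<turnstile> \<phi>"
proof (rule ccontr)
  assume "\<not> \<Gamma> \<turnstile> \<phi>"
  then obtain \<Delta> where \<Delta>: "\<Gamma> \<subseteq> \<Delta>" "\<phi> \<notin> \<Delta>" and closed: "\<And>\<psi>. \<Delta> \<turnstile> \<psi> \<longleftrightarrow> \<psi> \<in> \<Delta>"
    and max: "\<And>\<psi>. \<psi> \<notin> \<Delta> \<Longrightarrow> insert \<psi> \<Delta> \<turnstile> \<phi>"
    by (rule hilbert_Lindenbaum) blast
  \<comment> \<open>If both disjuncts were missing, maximality would derive \<phi> from each, and
    \<open>disj_cases\<close> would derive it from \<Delta>.\<close>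
  have prime: "p \<in> \<Delta> \<or> q \<in> \<Delta>" if "p \<^bold>\<or> q \<in> \<Delta>" for p q
    using disj_cases[of \<Delta> p q \<phi>] that \<Delta>(2) max closed by blast
  have consistent: "\<not> (p \<in> \<Delta> \<and> \<^bold>\<not> p \<in> \<Delta>)" for p
    using BK_explosion[of \<Delta> p \<phi>] \<Delta>(2) closed by blast
  define v where "v \<psi> = (if \<psi> \<in> \<Delta> then T else if \<^bold>\<not> \<psi> \<in> \<Delta> then F else U)" for \<psi>
  have vT: "v \<psi> = T \<longleftrightarrow> \<psi> \<in> \<Delta>" for \<psi>
    by (simp add: v_def)
  \<comment> \<open>The definition of \<open>v\<close> tests for T first, so consistency is required
    here.\<close>
  have vF: "v \<psi> = F \<longleftrightarrow> \<^bold>\<not> \<psi> \<in> \<Delta>" for \<psi>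
    using consistent by (auto simp: v_def)
  have vU: "v \<psi> = U \<longleftrightarrow> \<psi> \<notin> \<Delta> \<and> \<^bold>\<not> \<psi> \<notin> \<Delta>" for \<psi>
    by (simp add: v_def)
  have "valuation v"
    unfolding valuation_def
  proof (intro conjI allI)
    fix p q
    show "v (\<^bold>\<not> p) = neg_A (v p)"
      using negneg_I[of \<Delta> p] negneg_D[of \<Delta> p]
      by (intro tv_eqI) (auto simp: tv_neg_eq vT vF closed)
    have "p \<^bold>\<and> q \<in> \<Delta> \<longleftrightarrow> p \<in> \<Delta> \<and> q \<in> \<Delta>"
      using conj_I[of \<Delta> p q] conj_D1[of \<Delta> p q] conj_D2[of \<Delta> p q] closed by blast
    \<comment> \<open>Primeness turns \<not>p \<or> p and \<not>q \<or> q into definedness of both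
      conjuncts. They are not both true, as \<open>conj_I\<close> would then contradict
      consistency.\<close>
    moreover have "\<^bold>\<not> (p \<^bold>\<and> q) \<in> \<Delta> \<longleftrightarrow>
        (p \<in> \<Delta> \<or> \<^bold>\<not> p \<in> \<Delta>) \<and> (q \<in> \<Delta> \<or> \<^bold>\<not> q \<in> \<Delta>) \<and> (\<^bold>\<not> p \<in> \<Delta> \<or> \<^bold>\<not> q \<in> \<Delta>)"
      using neg_conj_FF[of \<Delta> p q] neg_conj_FT[of \<Delta> p q] neg_conj_TF[of \<Delta> p q]
        neg_conj_defined1[of \<Delta> p q] neg_conj_defined2[of \<Delta> p q] conj_I[of \<Delta> p q]
        prime[of "\<^bold>\<not> p" p] prime[of "\<^bold>\<not> q" q] consistent[of "p \<^bold>\<and> q"]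
      unfolding closed by blast
    ultimately show "v (p \<^bold>\<and> q) = conj_A (v p) (v q)"
      by (intro tv_eqI) (auto simp: tv_conj_eq_T tv_conj_eq_F vT vF vU)
    have "\<^bold>\<not> (p \<^bold>\<or> q) \<in> \<Delta> \<longleftrightarrow> \<^bold>\<not> p \<in> \<Delta> \<and> \<^bold>\<not> q \<in> \<Delta>"
      using neg_disj_I[of \<Delta> p q] neg_disj_D1[of \<Delta> p q] neg_disj_D2[of \<Delta> p q] closed by blast
    \<comment> \<open>From left to right, primeness is applied to p \<or> q and to both excluded
      middles that it yields; from right to left, each true row of the table has its own
      rule.\<close>
    moreover have "p \<^bold>\<or> q \<in> \<Delta> \<longleftrightarrow>
        (p \<in> \<Delta> \<or> \<^bold>\<not> p \<in> \<Delta>) \<and> (q \<in> \<Delta> \<or> \<^bold>\<not> q \<in> \<Delta>) \<and> (p \<in> \<Delta> \<or> q \<in> \<Delta>)"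
      using disj_FT[of \<Delta> p q] disj_TF[of \<Delta> p q] disj_TT[of \<Delta> p q]
        disj_defined1[of \<Delta> p q] disj_defined2[of \<Delta> p q]
        prime[of p q] prime[of p "\<^bold>\<not> p"] prime[of q "\<^bold>\<not> q"]
      unfolding closed by blast
    ultimately show "v (p \<^bold>\<or> q) = disj_A (v p) (v q)"
      by (intro tv_eqI) (auto simp: tv_disj_eq_T tv_disj_eq_F vT vF vU)
  qed
  moreover have "v ` \<Gamma> \<subseteq> {T}" using \<Delta>(1) by (auto simp: vT)
  moreover have "v \<phi> \<noteq> T" using \<Delta>(2) by (simp add: vT)
  ultimately show False using assms unfolding BK_consequence_def by blast
qed

theorem theorem8:
  shows "hilbert_consequence R_BK' = BK_consequence"
  by (intro ext iffI) (fact BK_sound BK_complete)+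

end
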